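(* Let $h:[0,\infty)\to\mathbb{R}$ be twice continuously differentiable and let $\phi(R)=2\big(h(0)-h(8R^2)\big)$ for $R\ge0$. Then $$\phi(R)=-16\,h'(0)R^2+O(R^4)\qquad\text{as }R\to0.$$
   Context: Here $h$ is the function for which the base field $u$ on $\mathbb{R}^D\times\mathbb{R}^D$ has isotropic covariance $k_u(x,y)=h(\|x-y\|_2^2)$, and $\phi(R)$ is the paper's expression for the upper bound on the error (of the quadratic Taylor approximation of $u(x^{(1)},x^{(2)})-u(x^{(2)},x^{(1)})$) in the local regime, $R$ being the range of distances of the inputs from the expansion point. Derivatives at $0$ are one-sided. *)

theory Defs
  imports Complex_Main "HOL-Library.Landau_Symbols"
begin

end

theory Submission
  imports Defs
begin

text \<open>
  The substitution \<open>x = 8 R\<^sup>2\<close>, which tends to \<open>0\<close> from the right as \<open>R\<close> does, turns the claim into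
  the first-order Taylor expansion \<open>h x = h 0 + h' 0 * x + O(x\<^sup>2)\<close>, with \<open>x\<^sup>2 = 64 R\<^sup>4\<close>. This one-sided
  expansion is \<open>first_order_taylor_at_right_0\<close>; it rests on the mean value theorem for \<open>h\<close> and the
  differentiability of \<open>h'\<close> at \<open>0\<close>.
\<close>

text \<open>
  By the mean value theorem the remainder equals \<open>(h' \<xi> - h' 0) * x\<close> for some \<open>\<xi>\<close> between \<open>0\<close> and
  \<open>x\<close>. The difference quotients of \<open>h'\<close> at \<open>0\<close> converge and so are bounded near \<open>0\<close>, which gives
  \<open>\<bar>h' \<xi> - h' 0\<bar> \<le> C * \<xi> \<le> C * x\<close> and hence a second factor \<open>x\<close>.
\<close>

lemma first_order_taylor_at_right_0:
  fixes h h' :: "real \<Rightarrow> real"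
  assumes h: "\<And>x. x \<ge> 0 \<Longrightarrow> (h has_real_derivative h' x) (at x within {0..})"
    and h': "(h' has_real_derivative d) (at 0 within {0..})"
  shows "(\<lambda>x. h x - h 0 - h' 0 * x) \<in> O[at_right 0](\<lambda>x. x\<^sup>2)"
proof -
  have "((\<lambda>x. (h' x - h' 0) / x) \<longlongrightarrow> d) (at_right 0)"
    using h' by (simp add: has_field_derivative_iff at_within_Ici_at_right)
  hence "(\<lambda>x. h' x - h' 0) \<in> O[at_right 0](\<lambda>x. x)"
    by (rule bigoI_tendsto) (auto simp: eventually_at_filter)
  then obtain C where "C > 0" and
    "eventually (\<lambda>x. norm (h' x - h' 0) \<le> C * norm x) (at_right 0)"
    by (elim landau_o.bigE)
  then obtain b where b: "b > 0"
    "\<And>x. 0 < x \<Longrightarrow> x < b \<Longrightarrow> \<bar>h' x - h' 0\<bar> \<le> C * \<bar>x\<bar>"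
    unfolding eventually_at_right_field by auto
  have bound: "\<bar>h x - h 0 - h' 0 * x\<bar> \<le> C * x\<^sup>2" if x: "0 < x" "x < b" for x
  proof -
    have "continuous_on {0..} h"
      using h by (intro DERIV_continuous_on) auto
    hence "continuous_on {0..x} h"
      by (rule continuous_on_subset) auto
    moreover have "(h has_derivative (*) (h' y)) (at y)" if "0 < y" for y
      using has_field_derivative_subset[OF h[of y], of "{0<..}"] that at_within_open[of y "{0<..}"]
      by (auto simp: has_field_derivative_def subset_eq)
    ultimately obtain \<xi> where \<xi>: "0 < \<xi>" "\<xi> < x" "h x - h 0 = h' \<xi> * (x - 0)"
      using mvt[OF x(1), of h "\<lambda>y. (*) (h' y)"] by auto
    have "\<bar>h x - h 0 - h' 0 * x\<bar> = \<bar>h' \<xi> - h' 0\<bar> * x"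
      using \<xi> x by (simp add: abs_mult flip: left_diff_distrib)
    also have "\<dots> \<le> (C * x) * x"
    proof (rule mult_right_mono)
      have "\<bar>h' \<xi> - h' 0\<bar> \<le> C * \<xi>"
        using b(2)[of \<xi>] \<xi> x by auto
      also have "\<dots> \<le> C * x"
        using \<xi>(2) \<open>C > 0\<close> by simp
      finally show "\<bar>h' \<xi> - h' 0\<bar> \<le> C * x" .
    qed (use x in simp)
    finally show ?thesis
      by (simp add: power2_eq_square mult.assoc)
  qed
  show ?thesis
  proof (rule bigoI)
    show "eventually (\<lambda>x. norm (h x - h 0 - h' 0 * x) \<le> C * norm (x\<^sup>2)) (at_right 0)"
      unfolding eventually_at_right_field using b(1) bound by auto
  qed
qed

theorem proposition38:
  fixes h h' h'' \<phi> :: "real \<Rightarrow> real"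
  assumes "\<And>x. x \<ge> 0 \<Longrightarrow> (h has_real_derivative h' x) (at x within {0..})"
    and "\<And>x. x \<ge> 0 \<Longrightarrow> (h' has_real_derivative h'' x) (at x within {0..})"
    and "continuous_on {0..} h''"
    and "\<And>R. R \<ge> 0 \<Longrightarrow> \<phi> R = 2 * (h 0 - h (8 * R\<^sup>2))"
  shows "(\<lambda>R. \<phi> R - (- 16 * h' 0 * R\<^sup>2)) \<in> O[at_right 0](\<lambda>R. R ^ 4)"
proof -
  have "((\<lambda>R::real. 8 * R\<^sup>2) \<longlongrightarrow> 8 * 0\<^sup>2) (at_right 0)"
    by (intro tendsto_intros)
  hence lim: "filterlim (\<lambda>R::real. 8 * R\<^sup>2) (at_right 0) (at_right 0)"
    by (auto simp: filterlim_at eventually_at_filter)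
  have "(\<lambda>R. h (8 * R\<^sup>2) - h 0 - h' 0 * (8 * R\<^sup>2)) \<in> O[at_right 0](\<lambda>R. (8 * R\<^sup>2)\<^sup>2)"
    using landau_o.big.compose[OF first_order_taylor_at_right_0[OF assms(1,2)] lim] by simp
  also have "(\<lambda>R::real. (8 * R\<^sup>2)\<^sup>2) = (\<lambda>R. 64 * R ^ 4)"
    by (simp add: power_mult_distrib flip: power_mult)
  finally have "(\<lambda>R. (- 2) * (h (8 * R\<^sup>2) - h 0 - h' 0 * (8 * R\<^sup>2))) \<in> O[at_right 0](\<lambda>R. R ^ 4)"
    by (subst landau_o.big.cmult_in_iff) simp_all
  moreover have "eventually (\<lambda>R. (- 2) * (h (8 * R\<^sup>2) - h 0 - h' 0 * (8 * R\<^sup>2)) =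
      \<phi> R - (- 16 * h' 0 * R\<^sup>2)) (at_right 0)"
    using assms(4) by (auto simp: eventually_at_filter algebra_simps)
  ultimately show ?thesis
    by (simp only: landau_o.big.in_cong)
qed

end
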